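(* For $k=0$ or $k=1$, \[\lim_{n\rightarrow \infty}\frac{M_k(n)}{p(n)}=\frac{1}{2}.\]
   Context: $p(n)$ denotes the number of partitions of $n$. For a partition $\lambda$ of a positive integer, let $\omega(\lambda)$ be the number of parts equal to $1$ and let $\nu(\lambda)$ be the number of parts of $\lambda$ strictly larger than $\omega(\lambda)$. The crank of $\lambda$ is its largest part if $\omega(\lambda)=0$, and $\nu(\lambda)-\omega(\lambda)$ if $\omega(\lambda)>0$. For $n\geq 0$, $M_0(n)$ (resp. $M_1(n)$) denotes the number of partitions of $n$ with even (resp. odd) crank. *)

theory Defs
  imports Complex_Main "HOL-Library.Multiset"
begin

definition partitions_of :: "nat \<Rightarrow> nat multiset set" where
  "partitions_of n = {L. 0 \<notin># L \<and> sum_mset L = n}"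

definition partition_number :: "nat \<Rightarrow> nat" where
  "partition_number n = card (partitions_of n)"

definition ones :: "nat multiset \<Rightarrow> nat" where
  "ones L = count L 1"

definition parts_above_ones :: "nat multiset \<Rightarrow> nat" where
  "parts_above_ones L = size {#x \<in># L. x > ones L#}"

(* The empty partition (n = 0), whose largest part is not defined, gets crank 0. *)
definition crank :: "nat multiset \<Rightarrow> int" where
  "crank L =
    (if L = {#} then 0
     else if ones L = 0 then int (Max_mset L)
     else int (parts_above_ones L) - int (ones L))"

(* Only k = 0 (even crank) and k = 1 (odd crank) are meaningful. *)
definition crank_parity_count :: "nat \<Rightarrow> nat \<Rightarrow> nat" where
  "crank_parity_count k n = card {L \<in> partitions_of n. crank L mod 2 = int k}"

lemma finite_partitions_of: "finite (partitions_of n)"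
proof (rule finite_subset)
  have bd: "x \<le> sum_mset L" if "x \<in># L" for x :: nat and L
    using sum_mset.remove[OF that] by linarith
  have sz: "size L \<le> sum_mset L" if "0 \<notin># L" for L :: "nat multiset"
    using that by (induction L) (simp_all add: Suc_le_eq)
  show "partitions_of n \<subseteq> mset ` {xs. set xs \<subseteq> {..n} \<and> length xs \<le> n}"
  proof
    fix L assume L: "L \<in> partitions_of n"
    then have n: "sum_mset L = n" and pos: "0 \<notin># L" by (auto simp: partitions_of_def)
    obtain xs where xs: "mset xs = L" using ex_mset by blast
    have "set xs \<subseteq> {..n}" using bd n xs by auto
    moreover have "length xs \<le> n" using sz[OF pos] n xs by auto
    ultimately show "L \<in> mset ` {xs. set xs \<subseteq> {..n} \<and> length xs \<le> n}" using xs by blast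
  qed
  show "finite (mset ` {xs. set xs \<subseteq> {..n} \<and> length xs \<le> n})"
    by (intro finite_imageI finite_lists_length_le) simp
qed

end

theory Submission
  imports Defs "HOL-Computational_Algebra.Formal_Power_Series" "HOL-Library.Discrete_Functions"
begin

text \<open>
  Sorting partitions by their number \<open>w\<close> of ones, the generating function of \<open>M\<^sub>0(n) - M\<^sub>1(n)\<close>
  becomes a sum over \<open>w\<close> that a case of the \<open>q\<close>-binomial theorem evaluates (for \<open>n \<ge> 2\<close>) as
  \<open>\<Prod>j\<ge>1. (1 - q\<^sup>j) / (1 + q\<^sup>j)\<^sup>2\<close>. By Gauss, \<open>\<Prod>j\<ge>1. (1 - q\<^sup>j) / (1 + q\<^sup>j)\<close> is the theta series
  \<open>1 + 2 \<Sum>k\<ge>1. (-1)\<^sup>k q^k\<^sup>2\<close>, and by Euler the other factor \<open>\<Prod>j\<ge>1. 1 / (1 + q\<^sup>j)\<close> is the product of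
  \<open>1 - q\<^sup>j\<close> over odd \<open>j\<close>. Hence \<open>|M\<^sub>0(n) - M\<^sub>1(n)|\<close> is at most of order \<open>sqrt n\<close> times the largest
  number of partitions of some \<open>m \<le> n\<close> into distinct odd parts. Removing the largest part of such a
  partition makes room for adding about \<open>sqrt n\<close> in the form of parts 1, 2 and 4, which can be
  done in at least a constant times \<open>n\<close> ways; so \<open>p(n)\<close> is larger by a factor of order \<open>sqrt n\<close>.
\<close>

unbundle fps_syntax

section \<open>Power series up to a given order\<close>

text \<open>Congruence modulo \<open>fps_X ^ Suc N\<close>. Finite products and sums can thus stand
  in for the infinite ones, without any convergence argument.\<close>

definition fps_eq_upto :: "nat \<Rightarrow> 'a::comm_ring_1 fps \<Rightarrow> 'a fps \<Rightarrow> bool" where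
  "fps_eq_upto N f g \<longleftrightarrow> (\<forall>i\<le>N. f $ i = g $ i)"

lemma fps_eq_upto_refl [simp]: "fps_eq_upto N f f"
  by (simp add: fps_eq_upto_def)

lemma fps_eq_upto_sym: "fps_eq_upto N f g \<Longrightarrow> fps_eq_upto N g f"
  by (simp add: fps_eq_upto_def)

lemma fps_eq_upto_trans [trans]:
  "fps_eq_upto N f g \<Longrightarrow> fps_eq_upto N g h \<Longrightarrow> fps_eq_upto N f h"
  by (simp add: fps_eq_upto_def)

lemma fps_eq_upto_add:
  "fps_eq_upto N f g \<Longrightarrow> fps_eq_upto N f' g' \<Longrightarrow> fps_eq_upto N (f + f') (g + g')"
  by (simp add: fps_eq_upto_def)

lemma fps_eq_upto_mult:
  "fps_eq_upto N f g \<Longrightarrow> fps_eq_upto N f' g' \<Longrightarrow> fps_eq_upto N (f * f') (g * g')"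
  by (auto simp: fps_eq_upto_def fps_mult_nth intro!: sum.cong)

lemma fps_eq_upto_prod:
  "(\<And>i. i \<in> A \<Longrightarrow> fps_eq_upto N (f i) (g i)) \<Longrightarrow> fps_eq_upto N (prod f A) (prod g A)"
  by (induction A rule: infinite_finite_induct) (auto intro: fps_eq_upto_mult)

lemma fps_eq_upto_sum:
  "(\<And>i. i \<in> A \<Longrightarrow> fps_eq_upto N (f i) (g i)) \<Longrightarrow> fps_eq_upto N (sum f A) (sum g A)"
  by (induction A rule: infinite_finite_induct) (auto intro: fps_eq_upto_add)

lemma fps_eq_upto_X_power: "N < k \<Longrightarrow> fps_eq_upto N (fps_X ^ k * f) 0"
  by (simp add: fps_eq_upto_def fps_X_power_mult_nth)

lemma fps_eq_upto_cancel:
  fixes f g h :: "'a::field fps"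
  assumes "fps_eq_upto N (h * f) (h * g)" "h $ 0 \<noteq> 0"
  shows "fps_eq_upto N f g"
proof -
  have "fps_eq_upto N (inverse h * (h * f)) (inverse h * (h * g))"
    using assms(1) by (rule fps_eq_upto_mult [OF fps_eq_upto_refl])
  moreover have "inverse h * (h * k) = k" for k
    using inverse_mult_eq_1 [OF assms(2)] by (metis mult.assoc mult_1)
  ultimately show ?thesis by simp
qed

lemma prod_fps_nth_0: "prod f A $ 0 = (\<Prod>i\<in>A. f i $ 0)"
  for f :: "'b \<Rightarrow> 'a::comm_ring_1 fps"
  by (induction A rule: infinite_finite_induct) auto

section \<open>Partitions with multiplicative weights\<close>

text \<open>For finite \<open>J\<close> without 0 this is the expansion of
  \<open>\<Prod>j\<in>J. 1 / (1 - e j * q ^ j)\<close> in powers of q.\<close>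

definition weighted_partition_fps :: "(nat \<Rightarrow> real) \<Rightarrow> nat set \<Rightarrow> real fps" where
  "weighted_partition_fps e J =
     Abs_fps (\<lambda>n. \<Sum>L | L \<in> partitions_of n \<and> set_mset L \<subseteq> J. \<Prod>x\<in>#L. e x)"

text \<open>A partition with parts in \<open>insert j J\<close> either avoids \<open>j\<close> or is
  one part \<open>j\<close> added to such a partition of \<open>n - j\<close>, which multiplies the
  weight by \<open>e j\<close>.\<close>

lemma weighted_partition_fps_insert:
  assumes "j \<notin> J" "j > 0"
  shows "weighted_partition_fps e (insert j J) * (1 - fps_const (e j) * fps_X ^ j) = weighted_partition_fps e J"
proof (rule fps_ext)
  fix n
  let ?S = "\<lambda>J n. {L. L \<in> partitions_of n \<and> set_mset L \<subseteq> J}"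
  let ?w = "\<lambda>L. \<Prod>x\<in>#L. e x"
  have fin: "finite (?S K m)" for K m
    by (rule finite_subset [OF _ finite_partitions_of [of m]]) auto
  have split: "?S (insert j J) n = ?S J n \<union> {L \<in> ?S (insert j J) n. j \<in># L}"
    by auto
  have "sum ?w (?S (insert j J) n) = sum ?w (?S J n) + sum ?w {L \<in> ?S (insert j J) n. j \<in># L}"
    using assms fin by (subst split, intro sum.union_disjoint) (auto intro: rev_finite_subset[OF fin])
  also have "sum ?w {L \<in> ?S (insert j J) n. j \<in># L} =
      (if n < j then 0 else e j * sum ?w (?S (insert j J) (n - j)))"
  proof (cases "n < j")
    case True
    have "{L \<in> ?S (insert j J) n. j \<in># L} = {}"
      using True by (auto simp: partitions_of_def dest: multi_member_split)
    then show ?thesis using True by (simp only: sum.empty) simp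
  next
    case False
    have "sum ?w {L \<in> ?S (insert j J) n. j \<in># L} = (\<Sum>L\<in>?S (insert j J) (n - j). e j * ?w L)"
    proof (rule sum.reindex_bij_witness [of _ "add_mset j" "\<lambda>L. L - {#j#}"])
      fix L assume "L \<in> {L \<in> ?S (insert j J) n. j \<in># L}"
      then obtain K where "L = add_mset j K" "L \<in> ?S (insert j J) n"
        by (auto dest: multi_member_split)
      then show "add_mset j (L - {#j#}) = L" "L - {#j#} \<in> ?S (insert j J) (n - j)"
          "e j * ?w (L - {#j#}) = ?w L"
        by (auto simp: partitions_of_def)
    qed (use False assms in \<open>auto simp: partitions_of_def\<close>)
    then show ?thesis using False by (simp add: sum_distrib_left)
  qed
  finally show "(weighted_partition_fps e (insert j J) * (1 - fps_const (e j) * fps_X ^ j)) $ n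
      = weighted_partition_fps e J $ n"
    by (simp add: weighted_partition_fps_def algebra_simps fps_X_power_mult_nth)
qed

lemma weighted_partition_fps_prod:
  assumes "finite J" "0 \<notin> J"
  shows "weighted_partition_fps e J * (\<Prod>j\<in>J. 1 - fps_const (e j) * fps_X ^ j) = 1"
  using assms
proof (induction J rule: finite_induct)
  case empty
  have *: "{L. L \<in> partitions_of n \<and> set_mset L \<subseteq> {}} = (if n = 0 then {{#}} else {})" for n
    by (auto simp: partitions_of_def)
  show ?case
    by (rule fps_ext) (simp only: weighted_partition_fps_def * prod.empty mult_1_right fps_nth_Abs_fps, simp)
next
  case (insert j J)
  then show ?case
    using weighted_partition_fps_insert [of j J e] by (simp add: mult.assoc [symmetric])
qed

section \<open>Product formulas\<close>

text \<open>The sum \<open>h m = (\<Sum>w\<le>N. a w * (- X\<^sup>m) ^ w)\<close> satisfies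
  \<open>(1 + X\<^sup>m) h m = (1 - t X\<^sup>m\<^sup>+\<^sup>1) h (m + 1)\<close> up to order \<open>N\<close>; iterating this from
  \<open>m = 1\<close> to \<open>m = N\<close> gives the product, since \<open>h (N + 1)\<close> is 1 up to order \<open>N\<close>.\<close>

lemma q_binomial_upto:
  fixes a :: "nat \<Rightarrow> real fps" and t :: "real fps"
  assumes a0: "a 0 = 1"
    and rec: "\<And>w. (1 - fps_X ^ Suc w) * a (Suc w) = (1 + t * fps_X ^ Suc w) * a w"
  shows "fps_eq_upto N ((\<Prod>m=1..N. 1 + fps_X ^ m) * (\<Sum>w\<le>N. a w * (- fps_X) ^ w))
           (\<Prod>m=1..N. 1 - t * fps_X ^ Suc m)"
proof -
  define h where "h m = (\<Sum>w\<le>N. a w * (- (fps_X ^ m)) ^ w)" for m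
  have step: "fps_eq_upto N ((1 + fps_X ^ m) * h m) ((1 - t * fps_X ^ Suc m) * h (Suc m))"
    if m: "m > 0" for m
  proof -
    define y where "y = - (fps_X ^ m :: real fps)"
    \<comment> \<open>This is the recursion for \<open>a\<close>, multiplied by
      \<open>y ^ Suc w\<close> and summed; the last term is what the truncation at \<open>k\<close>
      leaves over.\<close>
    have part: "(\<Sum>w\<le>k. a w * y ^ w) - (\<Sum>w\<le>k. a w * (y * fps_X) ^ w) =
        y * (\<Sum>w\<le>k. a w * y ^ w) + t * y * fps_X * (\<Sum>w\<le>k. a w * (y * fps_X) ^ w)
        - (1 + t * fps_X ^ Suc k) * a k * y ^ Suc k" for k
    proof (induction k)
      case (Suc k)
      have "a (Suc k) * y ^ Suc k - a (Suc k) * (y * fps_X) ^ Suc k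
          = ((1 - fps_X ^ Suc k) * a (Suc k)) * y ^ Suc k"
        by (simp add: algebra_simps power_mult_distrib)
      also have "\<dots> = (1 + t * fps_X ^ Suc k) * a k * y ^ Suc k"
        by (simp only: rec)
      finally show ?case
        using Suc by (simp add: algebra_simps power_mult_distrib)
    qed (simp add: a0 algebra_simps)
    have hm: "h m = (\<Sum>w\<le>N. a w * y ^ w)" "h (Suc m) = (\<Sum>w\<le>N. a w * (y * fps_X) ^ w)"
      by (simp_all add: h_def y_def mult.commute)
    have "(1 + fps_X ^ m) * h m = (1 - t * fps_X ^ Suc m) * h (Suc m)
        - (1 + t * fps_X ^ Suc N) * a N * y ^ Suc N"
      using part [of N] unfolding hm [symmetric] by (simp add: y_def algebra_simps)
    also have "\<dots> = (1 - t * fps_X ^ Suc m) * h (Suc m)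
        + fps_X ^ (m * Suc N) * (- ((1 + t * fps_X ^ Suc N) * a N * (-1) ^ Suc N))"
      by (simp add: y_def power_minus [of "fps_X ^ m"] power_mult [symmetric] power_add algebra_simps)
    finally have eq: "(1 + fps_X ^ m) * h m = (1 - t * fps_X ^ Suc m) * h (Suc m)
        + fps_X ^ (m * Suc N) * (- ((1 + t * fps_X ^ Suc N) * a N * (-1) ^ Suc N))" .
    \<comment> \<open>The leftover term thus vanishes up to order \<open>N\<close>; this is where
      \<open>m > 0\<close> matters.\<close>
    have "N < m * Suc N"
      using m by (cases m) auto
    then show ?thesis
      unfolding eq
      using fps_eq_upto_add [OF fps_eq_upto_refl fps_eq_upto_X_power] by (metis add.right_neutral)
  qed
  have iter: "fps_eq_upto N ((\<Prod>m=1..k. 1 + fps_X ^ m) * h 1) ((\<Prod>m=1..k. 1 - t * fps_X ^ Suc m) * h (Suc k))" for k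
  proof (induction k)
    case (Suc k)
    have "fps_eq_upto N ((1 + fps_X ^ Suc k) * ((\<Prod>m=1..k. 1 + fps_X ^ m) * h 1))
        ((1 + fps_X ^ Suc k) * ((\<Prod>m=1..k. 1 - t * fps_X ^ Suc m) * h (Suc k)))"
      using Suc by (rule fps_eq_upto_mult [OF fps_eq_upto_refl])
    also have "(1 + fps_X ^ Suc k) * ((\<Prod>m=1..k. 1 - t * fps_X ^ Suc m) * h (Suc k))
      = (\<Prod>m=1..k. 1 - t * fps_X ^ Suc m) * ((1 + fps_X ^ Suc k) * h (Suc k))"
      by (simp add: ac_simps)
    also have "fps_eq_upto N \<dots> ((\<Prod>m=1..k. 1 - t * fps_X ^ Suc m) *
        ((1 - t * fps_X ^ Suc (Suc k)) * h (Suc (Suc k))))"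
      by (rule fps_eq_upto_mult [OF fps_eq_upto_refl step]) simp
    finally show ?case
      by (simp add: ac_simps)
  qed simp
  have "fps_eq_upto N (h (Suc N)) (\<Sum>w\<le>N. if w = 0 then 1 else 0)"
    unfolding h_def
  proof (rule fps_eq_upto_sum)
    fix w
    show "fps_eq_upto N (a w * (- (fps_X ^ Suc N)) ^ w) (if w = 0 then 1 else 0)"
    proof (cases w)
      case (Suc v)
      then have w: "w \<noteq> 0" by simp
      have "(- (fps_X ^ Suc N)) ^ w = fps_X ^ (Suc N * w) * (- 1 :: real fps) ^ w"
        by (subst power_minus, subst power_mult, rule mult.commute)
      then have "a w * (- (fps_X ^ Suc N)) ^ w = fps_X ^ (Suc N * w) * (a w * (- 1) ^ w)"
        by (simp only: mult.left_commute)
      moreover have "N < Suc N * w" using Suc by simp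
      ultimately show ?thesis
        using fps_eq_upto_X_power [of N "Suc N * w" "a w * (- 1) ^ w"] by (simp only: w if_False)
    qed (simp add: a0)
  qed
  then have "fps_eq_upto N (h (Suc N)) 1" by simp
  then have "fps_eq_upto N ((\<Prod>m=1..N. 1 - t * fps_X ^ Suc m) * h (Suc N))
      ((\<Prod>m=1..N. 1 - t * fps_X ^ Suc m) * 1)"
    by (rule fps_eq_upto_mult [OF fps_eq_upto_refl])
  with iter [of N] have "fps_eq_upto N ((\<Prod>m=1..N. 1 + fps_X ^ m) * h 1) ((\<Prod>m=1..N. 1 - t * fps_X ^ Suc m) * 1)"
    by (rule fps_eq_upto_trans)
  then show ?thesis by (simp add: h_def)
qed

text \<open>Shanks's finite form of Gauss's identity. Here \<open>P s\<close> stands for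
  \<open>\<Prod>j=1..s. (1 - q\<^sup>j) / (1 + q\<^sup>j)\<close>, and \<open>I' s = 1 / P s\<close>, \<open>V' s = 2 / ((1 + q\<^sup>s) P s)\<close>;
  the hypotheses say this without division.\<close>

lemma Gauss_square_sum_telescope:
  fixes q :: "'a::comm_ring_1"
  assumes V0: "V' 0 = 1" and I0: "I' 0 = 1"
    and V1: "\<And>s. (1 + q ^ s) * V' s = 2 * I' s"
    and V2: "\<And>s. (1 - q ^ Suc s) * V' (Suc s) = 2 * I' s"
  shows "(\<Sum>s\<le>k. (-1) ^ s * V' s * q ^ (s * n) * ((1 - q ^ n) * q ^ s - (1 + q ^ n)))
      = - 2 * (-1) ^ k * q ^ (Suc k * n) * I' k"
proof (induction k)
  case (Suc k)
  \<comment> \<open>The factor is split so that \<open>V2\<close> and \<open>V1\<close> apply; the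
    piece with \<open>I' k\<close> cancels the previous partial sum.\<close>
  have "V' (Suc k) * ((1 - q ^ n) * q ^ Suc k - (1 + q ^ n))
      = - ((1 - q ^ Suc k) * V' (Suc k)) - q ^ n * ((1 + q ^ Suc k) * V' (Suc k))"
    by (simp add: algebra_simps)
  also have "\<dots> = - (2 * I' k) - q ^ n * (2 * I' (Suc k))"
    by (simp only: V1 V2)
  finally have eq: "V' (Suc k) * ((1 - q ^ n) * q ^ Suc k - (1 + q ^ n))
      = - (2 * I' k) - q ^ n * (2 * I' (Suc k))" .
  have "(-1) ^ Suc k * V' (Suc k) * q ^ (Suc k * n) * ((1 - q ^ n) * q ^ Suc k - (1 + q ^ n))
      = (-1) ^ Suc k * q ^ (Suc k * n) * (V' (Suc k) * ((1 - q ^ n) * q ^ Suc k - (1 + q ^ n)))"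
    by (simp only: ac_simps)
  also have "\<dots> = (-1) ^ Suc k * q ^ (Suc k * n) * (- (2 * I' k) - q ^ n * (2 * I' (Suc k)))"
    by (simp only: eq)
  finally show ?case
    using Suc by (simp add: algebra_simps power_add)
qed (simp add: V0 I0 algebra_simps)

text \<open>Induction on \<open>n\<close>. In the step to \<open>N = Suc n\<close>, the telescoped
  sum contributes \<open>2 * (-1) ^ N * q ^ (N * N)\<close> and the new term \<open>s = N\<close>
  contributes \<open>q ^ N\<close> times that, so a factor \<open>1 + q ^ N\<close> cancels and one
  more square is left.\<close>

lemma Gauss_square_sum:
  fixes q :: "'a::comm_ring_1"
  assumes V0: "V' 0 = 1" and I0: "I' 0 = 1" and P0: "P 0 = 1"
    and V1: "\<And>s. (1 + q ^ s) * V' s = 2 * I' s"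
    and V2: "\<And>s. (1 - q ^ Suc s) * V' (Suc s) = 2 * I' s"
    and PI: "\<And>s. P s * I' s = 1"
    and P: "\<And>s. (1 + q ^ Suc s) * P (Suc s) = (1 - q ^ Suc s) * P s"
    and cancel: "\<And>s x y. (1 + q ^ Suc s) * x = (1 + q ^ Suc s) * y \<Longrightarrow> x = y"
  shows "P n * (\<Sum>s\<le>n. (-1) ^ s * V' s * q ^ (s * Suc n)) = 1 + 2 * (\<Sum>k=1..n. (-1) ^ k * q ^ k\<^sup>2)"
proof (induction n)
  case (Suc n)
  define N where "N = Suc n"
  define S where "S m = (\<Sum>s\<le>n. (-1) ^ s * V' s * q ^ (s * m))" for m
  have tel: "(1 - q ^ N) * S (Suc N) - (1 + q ^ N) * S N = - 2 * (-1) ^ n * q ^ (N * N) * I' n"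
  proof -
    have "(1 - q ^ N) * S (Suc N) - (1 + q ^ N) * S N
        = (\<Sum>s\<le>n. (-1) ^ s * V' s * q ^ (s * N) * ((1 - q ^ N) * q ^ s - (1 + q ^ N)))"
      unfolding S_def sum_distrib_left sum_subtractf [symmetric]
      by (rule sum.cong) (simp_all add: algebra_simps power_add)
    also have "\<dots> = - 2 * (-1) ^ n * q ^ (Suc n * N) * I' n"
      by (rule Gauss_square_sum_telescope [OF V0 I0 V1 V2])
    finally show ?thesis by (simp only: N_def)
  qed
  have "(1 + q ^ N) * (P N * (\<Sum>s\<le>N. (-1) ^ s * V' s * q ^ (s * Suc N)))
      = ((1 + q ^ N) * P N) * S (Suc N) + (-1) ^ N * q ^ (N * Suc N) * (P N * ((1 + q ^ N) * V' N))"
    by (simp add: S_def N_def algebra_simps)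
  also have "\<dots> = ((1 - q ^ N) * P n) * S (Suc N) + (-1) ^ N * q ^ (N * Suc N) * 2 * (P N * I' N)"
    unfolding V1 using P [of n] by (simp only: N_def ac_simps)
  also have "\<dots> = P n * ((1 - q ^ N) * S (Suc N) - (1 + q ^ N) * S N) + (1 + q ^ N) * (P n * S N)
       + (-1) ^ N * q ^ (N * Suc N) * 2"
    unfolding PI by (simp add: algebra_simps)
  also have "\<dots> = - 2 * (-1) ^ n * q ^ (N * N) * (P n * I' n) + (1 + q ^ N) * (P n * S N)
       + (-1) ^ N * q ^ (N * Suc N) * 2"
    unfolding tel by (simp add: algebra_simps)
  also have "\<dots> = (1 + q ^ N) * (P n * S N + 2 * (-1) ^ N * q ^ (N * N))"
    unfolding PI by (simp add: N_def algebra_simps power_add)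
  finally have "P N * (\<Sum>s\<le>N. (-1) ^ s * V' s * q ^ (s * Suc N)) = P n * S N + 2 * (-1) ^ N * q ^ (N * N)"
    unfolding N_def by (rule cancel)
  with Suc show ?case
    by (simp add: S_def N_def power2_eq_square algebra_simps)
qed (use V0 P0 in simp)

section \<open>Finite q-factorials and the identities of Gauss and Euler\<close>

definition qfact_minus :: "nat \<Rightarrow> real fps" where
  "qfact_minus n = (\<Prod>j=1..n. 1 - fps_X ^ j)"

definition qfact_plus :: "nat \<Rightarrow> real fps" where
  "qfact_plus n = (\<Prod>j=1..n. 1 + fps_X ^ j)"

text \<open>The bound is on the exponent, not on the number of factors, so these are exactly the
  factors of \<open>qfact_minus n\<close> with odd exponent.\<close>

definition odd_qfact :: "nat \<Rightarrow> real fps" where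
  "odd_qfact n = (\<Prod>j | j \<le> n \<and> odd j. 1 - fps_X ^ j)"

lemma qfact_nth_0 [simp]: "qfact_minus n $ 0 = 1" "qfact_plus n $ 0 = 1"
  by (simp_all add: qfact_minus_def qfact_plus_def prod_fps_nth_0)

lemma qfact_0 [simp]: "qfact_minus 0 = 1" "qfact_plus 0 = 1"
  by (simp_all add: qfact_minus_def qfact_plus_def)

lemma qfact_Suc:
  "qfact_minus (Suc n) = (1 - fps_X ^ Suc n) * qfact_minus n"
  "qfact_plus (Suc n) = (1 + fps_X ^ Suc n) * qfact_plus n"
  by (simp_all add: qfact_minus_def qfact_plus_def mult.commute)

lemma inverse_qfact:
  "qfact_minus n * inverse (qfact_minus n) = 1"
  "qfact_plus n * inverse (qfact_plus n) = 1"
  by (simp_all add: inverse_mult_eq_1')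

text \<open>In \<open>Gauss_square_sum\<close> for \<open>q = fps_X\<close>, the terms with
  \<open>s > 0\<close> on the left are divisible by \<open>fps_X ^ Suc N\<close>. Up to order
  \<open>N\<close> only \<open>P N\<close> remains there.\<close>

lemma Gauss_theta_upto:
  "fps_eq_upto N (qfact_minus N) (qfact_plus N * (1 + 2 * (\<Sum>k=1..N. (-1) ^ k * fps_X ^ k\<^sup>2)))"
proof -
  define P where "P n = qfact_minus n * inverse (qfact_plus n)" for n
  define I' where "I' n = qfact_plus n * inverse (qfact_minus n)" for n
  \<comment> \<open>At \<open>n = 0\<close> the series inverted is the constant 2, so the factor 2
    makes \<open>V' 0 = 1\<close>.\<close>
  define V' where "V' n = 2 * inverse (1 + fps_X ^ n) * I' n" for n
  have nz: "(1 + fps_X ^ n :: real fps) $ 0 \<noteq> 0" for n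
    by (cases n) auto
  have nz': "1 + fps_X ^ n \<noteq> (0 :: real fps)" for n
    using nz [of n] by (metis fps_zero_nth)
  have nzm: "1 - fps_X ^ Suc n \<noteq> (0 :: real fps)" for n
    by (metis diff_zero fps_X_power_nth fps_one_nth fps_sub_nth fps_zero_nth nat.distinct(1) zero_neq_one)
  have qnz: "qfact_plus n \<noteq> 0" "qfact_minus n \<noteq> 0" for n
    using qfact_nth_0 [of n] by (metis fps_zero_nth zero_neq_one)+
  have inv: "(1 + fps_X ^ n) * inverse (1 + fps_X ^ n :: real fps) = 1" for n
    by (rule inverse_mult_eq_1' [OF nz])
  have V1: "(1 + fps_X ^ s) * V' s = 2 * I' s" for s
    using inv [of s] by (simp add: V'_def algebra_simps)
  have I0: "I' 0 = 1" by (simp add: I'_def)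
  have V0: "V' 0 = 1"
    using V1 [of 0] I0 nz' [of 0] by simp
  have PI: "P s * I' s = 1" for s
    unfolding P_def I'_def using inverse_qfact [of s] by (metis mult.assoc mult.commute mult_1)
  have Pq: "qfact_plus s * P s = qfact_minus s" for s
    unfolding P_def using inverse_qfact [of s] by (metis mult.left_commute mult.right_neutral)
  have Pstep: "(1 + fps_X ^ Suc s) * P (Suc s) = (1 - fps_X ^ Suc s) * P s" for s
  proof -
    have "qfact_plus s * ((1 + fps_X ^ Suc s) * P (Suc s)) = qfact_plus s * ((1 - fps_X ^ Suc s) * P s)"
      using Pq [of "Suc s"] Pq [of s] unfolding qfact_Suc by (metis (no_types, lifting) mult.assoc mult.commute)
    then show ?thesis using qnz(1) mult_left_cancel by blast
  qed
  \<comment> \<open>After multiplication by \<open>P s\<close>, the recursion for \<open>P\<close>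
    exchanges the factor with minus for the one with plus, to which \<open>V1\<close>
    applies.\<close>
  have V2: "(1 - fps_X ^ Suc s) * V' (Suc s) = 2 * I' s" for s
  proof -
    have "P s * ((1 - fps_X ^ Suc s) * V' (Suc s)) = (1 + fps_X ^ Suc s) * P (Suc s) * V' (Suc s)"
      unfolding Pstep by (simp only: ac_simps)
    also have "\<dots> = P (Suc s) * ((1 + fps_X ^ Suc s) * V' (Suc s))"
      by (simp only: ac_simps)
    also have "\<dots> = 2 * (P (Suc s) * I' (Suc s))"
      unfolding V1 by (simp only: ac_simps)
    also have "\<dots> = P s * (2 * I' s)"
      using PI [of s] PI [of "Suc s"] by (simp add: mult.left_commute)
    finally show ?thesis
      using PI [of s] by (metis mult_left_cancel mult_zero_left zero_neq_one)
  qed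
  have cancel: "x = y" if "(1 + fps_X ^ Suc s) * x = (1 + fps_X ^ Suc s) * y" for s and x y :: "real fps"
    using that nz' [of "Suc s"] by (metis mult_left_cancel)
  have P0: "P 0 = 1" by (simp add: P_def)
  have G: "P N * (\<Sum>s\<le>N. (-1) ^ s * V' s * fps_X ^ (s * Suc N))
      = 1 + 2 * (\<Sum>k=1..N. (-1) ^ k * fps_X ^ k\<^sup>2)"
    by (rule Gauss_square_sum [where I' = I', OF V0 I0 P0 V1 V2 PI Pstep cancel])
  have "fps_eq_upto N (\<Sum>s\<le>N. (-1) ^ s * V' s * fps_X ^ (s * Suc N)) (\<Sum>s\<le>N. if s = 0 then 1 else 0)"
  proof (rule fps_eq_upto_sum)
    fix s
    show "fps_eq_upto N ((-1) ^ s * V' s * fps_X ^ (s * Suc N)) (if s = 0 then 1 else 0)"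
    proof (cases s)
      case (Suc v)
      then have "N < s * Suc N" by simp
      from fps_eq_upto_X_power [OF this, of "(-1) ^ s * V' s"] show ?thesis
        using Suc by (simp only: mult.commute) simp
    qed (simp add: V0)
  qed
  from fps_eq_upto_mult [OF fps_eq_upto_refl this, of "P N"]
  have "fps_eq_upto N (1 + 2 * (\<Sum>k=1..N. (-1) ^ k * fps_X ^ k\<^sup>2)) (P N)"
    unfolding G by simp
  from fps_eq_upto_mult [OF fps_eq_upto_refl this, of "qfact_plus N"] show ?thesis
    unfolding Pq by (rule fps_eq_upto_sym)
qed

text \<open>Since \<open>(1 + q ^ j) * (1 - q ^ j) = 1 - q ^ (2 * j)\<close>, the product
  \<open>qfact_plus N * qfact_minus N\<close> has only even exponents. The factors with even
  exponent at most \<open>N\<close> (\<open>E\<close>) occur on both sides and cancel; the others on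
  the right are 1 up to order \<open>N\<close>.\<close>

lemma Euler_odd_upto: "fps_eq_upto N (qfact_plus N * odd_qfact N) 1"
proof -
  define E :: "real fps" where "E = (\<Prod>j | 0 < j \<and> j \<le> N \<and> even j. 1 - fps_X ^ j)"
  have "{1..N} = {j. j \<le> N \<and> odd j} \<union> {j. 0 < j \<and> j \<le> N \<and> even j}"
    by (auto simp: Suc_le_eq intro: odd_pos)
  then have "qfact_minus N = odd_qfact N * E"
    unfolding qfact_minus_def odd_qfact_def E_def
    by (simp only:, intro prod.union_disjoint) auto
  moreover have "qfact_plus N * qfact_minus N = (\<Prod>j=1..N. 1 - fps_X ^ (2 * j))"
    unfolding qfact_minus_def qfact_plus_def prod.distrib [symmetric]
    by (intro prod.cong) (auto simp: algebra_simps mult_2_right simp flip: power_add)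
  moreover have "(\<Prod>j=1..N. 1 - fps_X ^ (2 * j)) = (\<Prod>j\<in>(*) 2 ` {1..N}. 1 - fps_X ^ j :: real fps)"
    by (subst prod.reindex) (auto simp: inj_on_def)
  moreover have "(\<Prod>j\<in>(*) 2 ` {1..N}. 1 - fps_X ^ j :: real fps) =
     E * (\<Prod>j\<in>(*) 2 ` {1..N} - {..N}. 1 - fps_X ^ j)"
  proof -
    have "(*) 2 ` {1..N} = {j. 0 < j \<and> j \<le> N \<and> even j} \<union> ((*) 2 ` {1..N} - {..N})"
      by (auto simp: image_iff elim!: evenE)
    then show ?thesis
      unfolding E_def by (subst prod.union_disjoint [symmetric]) auto
  qed
  ultimately have eq: "E * (qfact_plus N * odd_qfact N) = E * (\<Prod>j\<in>(*) 2 ` {1..N} - {..N}. 1 - fps_X ^ j)"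
    by (simp add: ac_simps)
  have "fps_eq_upto N (\<Prod>j\<in>(*) 2 ` {1..N} - {..N}. 1 - fps_X ^ j :: real fps) (\<Prod>j\<in>(*) 2 ` {1..N} - {..N}. 1)"
    by (intro fps_eq_upto_prod) (auto simp: fps_eq_upto_def fps_X_power_iff)
  from fps_eq_upto_mult [OF fps_eq_upto_refl this, of E]
  have "fps_eq_upto N (E * (qfact_plus N * odd_qfact N)) (E * 1)"
    unfolding eq by simp
  moreover have "E $ 0 \<noteq> 0"
    unfolding E_def by (simp add: prod_fps_nth_0)
  ultimately show ?thesis
    by (rule fps_eq_upto_cancel)
qed

section \<open>The generating function of the crank parity\<close>

text \<open>The sign \<open>(-1) ^ crank L\<close>, defined through parity since the crank can be
  negative. Its sum over the partitions of n is M_0(n) - M_1(n).\<close>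

definition crank_sign :: "nat multiset \<Rightarrow> real" where
  "crank_sign L = (if even (crank L) then 1 else -1)"

text \<open>With \<open>w\<close> the number of ones, the product of these weights over the parts is
  \<open>(-1) ^ parts_above_ones L\<close>.\<close>

definition crank_weight :: "nat \<Rightarrow> nat \<Rightarrow> real" where
  "crank_weight w j = (if w < j then -1 else 1)"

lemma prod_crank_weight: "(\<Prod>x\<in>#L. crank_weight w x) = (-1) ^ size {#x \<in># L. x > w#}"
  by (induction L) (auto simp: crank_weight_def)

lemma minus_X_power_mult_nth:
  "((- fps_X) ^ w * f) $ n = (if n < w then 0 else (-1) ^ w * f $ (n - w))" for f :: "real fps"
proof -
  have "(- fps_X) ^ w * f = fps_X ^ w * (fps_const ((-1) ^ w) * f)"
    by (subst power_minus) (simp add: fps_const_power [symmetric] ac_simps del: fps_const_power flip: fps_const_neg)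
  then show ?thesis
    by (simp only: fps_X_power_mult_nth fps_mult_left_const_nth)
qed

lemma part_le: "L \<in> partitions_of n \<Longrightarrow> x \<in># L \<Longrightarrow> x \<le> n"
  by (auto simp: partitions_of_def dest: multi_member_split)

lemma part_pos: "L \<in> partitions_of n \<Longrightarrow> x \<in># L \<Longrightarrow> x > 0"
  by (auto simp: partitions_of_def intro: Nat.gr0I)

lemma finite_partitions_Collect [simp]: "finite {L. L \<in> partitions_of n \<and> P L}"
  by (rule finite_subset [OF _ finite_partitions_of [of n]]) auto

text \<open>Deleting the \<open>w\<close> ones leaves a partition of \<open>n - w\<close> into parts
  at least 2. As \<open>w \<ge> 1\<close>, no part above \<open>w\<close> is lost, so the sign is
  \<open>(-1) ^ w\<close> times the product of the weights.\<close>

lemma sum_crank_sign_ones: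
  assumes "1 \<le> w" "w \<le> n"
  shows "(\<Sum>L | L \<in> partitions_of n \<and> ones L = w. crank_sign L) =
    ((- fps_X) ^ w * weighted_partition_fps (crank_weight w) {2..n}) $ n"
proof -
  let ?S = "{L. L \<in> partitions_of (n - w) \<and> set_mset L \<subseteq> {2..n}}"
  have eq: "filter_mset (\<lambda>x. x \<noteq> 1) L + replicate_mset w 1 = L" if "ones L = w" for L
    using that by (auto simp: multiset_eq_iff ones_def)
  have "(\<Sum>L | L \<in> partitions_of n \<and> ones L = w. crank_sign L) =
      (\<Sum>L\<in>?S. (-1) ^ w * (\<Prod>x\<in>#L. crank_weight w x))"
  proof (rule sum.reindex_bij_witness [of _ "\<lambda>L. L + replicate_mset w 1" "filter_mset (\<lambda>x. x \<noteq> 1)"])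
    fix L assume L: "L \<in> {L. L \<in> partitions_of n \<and> ones L = w}"
    let ?K = "filter_mset (\<lambda>x. x \<noteq> 1) L"
    from L have e: "?K + replicate_mset w 1 = L" by (intro eq) auto
    show "?K + replicate_mset w 1 = L" by (rule e)
    have "sum_mset L = sum_mset ?K + w"
      by (subst e [symmetric]) (simp only: sum_mset.union sum_mset_replicate_mset, simp)
    moreover have "2 \<le> x \<and> x \<le> n" if "x \<in># ?K" for x
    proof -
      have "x \<in># L" "x \<noteq> 1" using that by auto
      then show ?thesis
        using L part_le [of L n x] part_pos [of L n x] by auto
    qed
    ultimately show "?K \<in> ?S"
      using L by (auto simp: partitions_of_def)
    have ne: "L \<noteq> {#}" using L assms by (auto simp: ones_def)
    have "{#x \<in># L. x > w#} = {#x \<in># ?K. x > w#}"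
      using assms by (auto simp: multiset_eq_iff)
    then have "crank L = int (size {#x \<in># ?K. x > w#}) - int w"
      using L assms ne by (simp add: crank_def parts_above_ones_def)
    then show "(-1) ^ w * (\<Prod>x\<in>#?K. crank_weight w x) = crank_sign L"
      unfolding prod_crank_weight crank_sign_def
      by (simp flip: power_add)
  next
    fix L assume L: "L \<in> ?S"
    then have "1 \<notin># L" by auto
    then have c: "count L 1 = 0" by (simp add: count_eq_zero_iff)
    then show "filter_mset (\<lambda>x. x \<noteq> 1) (L + replicate_mset w 1) = L"
      by (auto simp: multiset_eq_iff)
    show "L + replicate_mset w 1 \<in> {L. L \<in> partitions_of n \<and> ones L = w}"
      using L c assms by (auto simp: partitions_of_def ones_def)
  qed
  then show ?thesis
    using assms by (simp add: minus_X_power_mult_nth weighted_partition_fps_def sum_distrib_left)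
qed

text \<open>Sorted by the largest part \<open>l\<close>. All weights \<open>crank_weight l j\<close> with \<open>j \<le> l\<close> are 1, so
  this only counts the remaining parts.\<close>

lemma sum_crank_sign_no_ones:
  assumes "n > 0"
  shows "(\<Sum>L | L \<in> partitions_of n \<and> ones L = 0. crank_sign L) =
    (\<Sum>l=2..n. (- fps_X) ^ l * weighted_partition_fps (crank_weight l) {2..l}) $ n"
proof -
  let ?A = "{L. L \<in> partitions_of n \<and> ones L = 0}"
  have ne: "L \<noteq> {#}" if "L \<in> ?A" for L
    using that assms by (auto simp: partitions_of_def)
  have ge2: "x \<in> {2..n}" if "L \<in> ?A" "x \<in># L" for L x
  proof -
    have "x \<noteq> 1" using that by (auto simp: ones_def count_eq_zero_iff)
    then show ?thesis using that part_le [of L n x] part_pos [of L n x] by auto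
  qed
  have maxin: "Max_mset L \<in># L" if "L \<in> ?A" for L
    using ne [OF that] by (intro Max_in) auto
  have "sum crank_sign ?A = (\<Sum>l\<in>{2..n}. \<Sum>L | L \<in> ?A \<and> Max_mset L = l. crank_sign L)"
  proof (rule sum.group [symmetric])
    show "Max_mset ` ?A \<subseteq> {2..n}" using ge2 maxin by blast
  qed simp_all
  also have "\<dots> = (\<Sum>l\<in>{2..n}. ((- fps_X) ^ l * weighted_partition_fps (crank_weight l) {2..l}) $ n)"
  proof (rule sum.cong)
    fix l assume l: "l \<in> {2..n}"
    let ?S = "{L. L \<in> partitions_of (n - l) \<and> set_mset L \<subseteq> {2..l}}"
    have "(\<Sum>L | L \<in> ?A \<and> Max_mset L = l. crank_sign L) =
      (\<Sum>L\<in>?S. (-1) ^ l * (\<Prod>x\<in>#L. crank_weight l x))"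
    proof (rule sum.reindex_bij_witness [of _ "add_mset l" "\<lambda>L. L - {#l#}"])
      fix L assume L: "L \<in> {L. L \<in> ?A \<and> Max_mset L = l}"
      then have LA: "L \<in> ?A" and Lmax: "Max_mset L = l" by auto
      with maxin have "l \<in># L" by blast
      then obtain K where K: "L = add_mset l K" by (auto dest: multi_member_split)
      then show "add_mset l (L - {#l#}) = L" by simp
      have le: "x \<in> {2..l}" if "x \<in># K" for x
        using that ge2 [OF LA, of x] Lmax Max_ge [of "set_mset L" x] by (auto simp: K)
      then show "L - {#l#} \<in> ?S"
        using LA by (auto simp: K partitions_of_def)
      have no_larger: "filter_mset ((<) l) K = {#}"
        using le by (auto simp: not_less)
      show "(-1) ^ l * (\<Prod>x\<in>#L - {#l#}. crank_weight l x) = crank_sign L"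
        using LA Lmax ne [OF LA] unfolding prod_crank_weight
        by (simp add: K no_larger crank_sign_def crank_def minus_one_power_iff)
    next
      fix L assume L: "L \<in> ?S"
      have "Max (set_mset (add_mset l L)) = l"
        using L by (intro Max_eqI) auto
      then show "add_mset l L \<in> {L. L \<in> ?A \<and> Max_mset L = l}"
        using L l by (auto simp: partitions_of_def ones_def count_eq_zero_iff)
    qed auto
    then show "(\<Sum>L | L \<in> ?A \<and> Max_mset L = l. crank_sign L) =
        ((- fps_X) ^ l * weighted_partition_fps (crank_weight l) {2..l}) $ n"
      using l by (simp add: minus_X_power_mult_nth weighted_partition_fps_def sum_distrib_left)
  qed simp
  finally show ?thesis by (simp add: fps_sum_nth)
qed

text \<open>The factor \<open>1 - fps_X\<close> supplies the missing part 1. The denominator then is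
  \<open>1 - q ^ j\<close> for \<open>j \<le> w\<close> and \<open>1 + q ^ j\<close> beyond, and the
  latter factors cancel against those of \<open>qfact_plus n\<close>.\<close>

lemma weighted_partition_fps_crank_weight:
  assumes "1 \<le> w" "w \<le> n"
  shows "weighted_partition_fps (crank_weight w) {2..n} * qfact_plus n
    = (1 - fps_X) * (qfact_plus w * inverse (qfact_minus w))"
proof -
  define W where "W = weighted_partition_fps (crank_weight w) {2..n}"
  define D :: "real fps" where "D = (\<Prod>j=2..n. 1 - fps_const (crank_weight w j) * fps_X ^ j)"
  define R :: "real fps" where "R = (\<Prod>j=w+1..n. 1 + fps_X ^ j)"
  have WD: "W * D = 1"
    unfolding W_def D_def by (rule weighted_partition_fps_prod) auto
  have "{1..n} = insert 1 {2..n}" using assms by auto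
  then have "(1 - fps_X) * D = (\<Prod>j=1..n. 1 - fps_const (crank_weight w j) * fps_X ^ j)"
    using assms by (simp add: D_def crank_weight_def)
  also have "\<dots> = (\<Prod>j=1..w. 1 - fps_const (crank_weight w j) * fps_X ^ j) *
      (\<Prod>j=w+1..n. 1 - fps_const (crank_weight w j) * fps_X ^ j)"
    using prod.ub_add_nat [of 1 w _ "n - w"] assms by simp
  also have "(\<Prod>j=1..w. 1 - fps_const (crank_weight w j) * fps_X ^ j) = qfact_minus w"
    unfolding qfact_minus_def by (rule prod.cong) (auto simp: crank_weight_def)
  also have "(\<Prod>j=w+1..n. 1 - fps_const (crank_weight w j) * fps_X ^ j) = R"
    unfolding R_def by (rule prod.cong) (auto simp: crank_weight_def simp flip: fps_const_neg)
  finally have D: "(1 - fps_X) * D = qfact_minus w * R" .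
  have Q: "qfact_plus n = qfact_plus w * R"
    unfolding qfact_plus_def R_def using prod.ub_add_nat [of 1 w _ "n - w"] assms by simp
  have "W * qfact_plus n = W * (qfact_plus w * R) * (qfact_minus w * inverse (qfact_minus w))"
    unfolding inverse_qfact Q by simp
  also have "\<dots> = qfact_plus w * inverse (qfact_minus w) * W * (qfact_minus w * R)"
    by (simp only: ac_simps)
  also have "\<dots> = (1 - fps_X) * (qfact_plus w * inverse (qfact_minus w)) * (W * D)"
    unfolding D [symmetric] by (simp only: ac_simps)
  finally show ?thesis unfolding WD by (simp add: W_def)
qed

text \<open>Here \<open>F\<close> collects the partitions without ones and \<open>G\<close> those
  with ones. Up to initial terms, \<open>F\<close> and \<open>Q * G\<close> are
  \<open>1 - fps_X\<close> times \<open>SB\<close> and \<open>SA\<close>, which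
  \<open>q_binomial_upto\<close> evaluates with \<open>t = 0\<close> and
  \<open>t = 1\<close>.\<close>

lemma sum_crank_sign_eq:
  assumes "n \<ge> 2"
  shows "(\<Sum>L\<in>partitions_of n. crank_sign L) =
    (odd_qfact n * (1 + 2 * (\<Sum>k=1..n. (-1) ^ k * fps_X ^ k\<^sup>2))) $ n"
proof -
  define W where "W w m = weighted_partition_fps (crank_weight w) {2..m}" for w m
  define Q where "Q = qfact_plus n"
  define a where "a w = qfact_plus w * inverse (qfact_minus w)" for w
  define b where "b w = inverse (qfact_minus w)" for w
  define SA where "SA = (\<Sum>w\<le>n. a w * (- fps_X) ^ w)"
  define SB where "SB = (\<Sum>w\<le>n. b w * (- fps_X) ^ w)"
  define \<theta> :: "real fps" where "\<theta> = 1 + 2 * (\<Sum>k=1..n. (-1) ^ k * fps_X ^ k\<^sup>2)"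
  have Q0: "Q $ 0 \<noteq> 0" by (simp add: Q_def)
  have WQ: "W w n * Q = (1 - fps_X) * a w" if "1 \<le> w" "w \<le> n" for w
    using weighted_partition_fps_crank_weight [OF that] by (simp add: W_def Q_def a_def)
  have WB: "W l l = (1 - fps_X) * b l" if "1 \<le> l" for l
  proof -
    have "W l l * qfact_plus l * inverse (qfact_plus l) = (1 - fps_X) * (qfact_plus l * b l) * inverse (qfact_plus l)"
      using weighted_partition_fps_crank_weight [OF that order_refl] by (simp only: W_def b_def)
    then show ?thesis
      using inverse_qfact(2) [of l] by (metis (no_types, lifting) mult.assoc mult.commute mult_1)
  qed
  have brec: "(1 - fps_X ^ Suc w) * b (Suc w) = b w" for w
  proof -
    have "qfact_minus w * ((1 - fps_X ^ Suc w) * b (Suc w)) = qfact_minus w * b w"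
      using inverse_qfact(1) [of w] inverse_qfact(1) [of "Suc w"] unfolding qfact_Suc b_def
      by (simp only: ac_simps)
    moreover have "qfact_minus w \<noteq> 0"
      using qfact_nth_0(1) [of w] by (metis fps_zero_nth zero_neq_one)
    ultimately show ?thesis using mult_left_cancel by blast
  qed
  have arec: "(1 - fps_X ^ Suc w) * a (Suc w) = (1 + 1 * fps_X ^ Suc w) * a w" for w
  proof -
    have "(1 - fps_X ^ Suc w) * a (Suc w)
        = (1 + fps_X ^ Suc w) * (qfact_plus w * ((1 - fps_X ^ Suc w) * b (Suc w)))"
      by (simp only: a_def b_def qfact_Suc ac_simps)
    then show ?thesis unfolding brec by (simp add: a_def b_def)
  qed
  have A: "fps_eq_upto n (Q * SA) (\<Prod>m=1..n. 1 - 1 * fps_X ^ Suc m)"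
    unfolding Q_def SA_def qfact_plus_def by (rule q_binomial_upto [OF _ arec]) (simp add: a_def)
  have "fps_eq_upto n (Q * SB) (\<Prod>m=1..n. 1 - 0 * fps_X ^ Suc m)"
    unfolding Q_def SB_def qfact_plus_def using brec by (intro q_binomial_upto) (simp_all add: b_def)
  then have B: "fps_eq_upto n (Q * SB) 1" by simp
  have "(1 - fps_X) * (\<Prod>m=1..n. 1 - 1 * fps_X ^ Suc m) = qfact_minus (Suc n)"
  proof -
    have "(1 - fps_X) * (\<Prod>m=1..k. 1 - 1 * fps_X ^ Suc m) = qfact_minus (Suc k)" for k
      by (induction k) (simp_all add: qfact_Suc ac_simps)
    then show ?thesis .
  qed
  also have "\<dots> = qfact_minus n + fps_X ^ Suc n * (- qfact_minus n)"
    by (simp add: qfact_Suc algebra_simps)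
  finally have M: "(1 - fps_X) * (\<Prod>m=1..n. 1 - 1 * fps_X ^ Suc m)
      = qfact_minus n + fps_X ^ Suc n * (- qfact_minus n)" .
  \<comment> \<open>Up to order \<open>n\<close> the shifted product has become
    \<open>qfact_minus n\<close>, which Gauss's identity writes as
    \<open>Q * \<theta>\<close>.\<close>
  have "fps_eq_upto n ((1 - fps_X) * (Q * SA)) (qfact_minus n + fps_X ^ Suc n * (- qfact_minus n))"
    using fps_eq_upto_mult [OF fps_eq_upto_refl A, of "1 - fps_X"] unfolding M .
  also have "fps_eq_upto n \<dots> (qfact_minus n + 0)"
    by (rule fps_eq_upto_add [OF fps_eq_upto_refl fps_eq_upto_X_power]) simp
  also have "fps_eq_upto n (qfact_minus n + 0) (Q * \<theta>)"
    using Gauss_theta_upto by (simp add: Q_def \<theta>_def)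
  finally have "fps_eq_upto n (Q * ((1 - fps_X) * SA)) (Q * \<theta>)"
    by (simp only: mult.left_commute)
  from fps_eq_upto_cancel [OF this Q0] have T: "fps_eq_upto n ((1 - fps_X) * SA) \<theta>" .
  define F where "F = (\<Sum>l=2..n. (- fps_X) ^ l * W l l)"
  define G where "G = (\<Sum>w=1..n. (- fps_X) ^ w * W w n)"
  have F': "F = (1 - fps_X) * (\<Sum>w=2..n. b w * (- fps_X) ^ w)"
    unfolding F_def sum_distrib_left by (rule sum.cong) (simp_all add: WB ac_simps)
  have "{..n} = insert 0 (insert 1 {2..n})" using assms by auto
  then have SB: "(1 - fps_X) * SB = (1 - fps_X) + (1 - fps_X) * b 1 * (- fps_X) + F"
    unfolding SB_def F' by (simp add: b_def algebra_simps sum_distrib_left)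
  have b1: "(1 - fps_X) * b 1 = 1" using brec [of 0] by (simp add: b_def)
  have F: "F = (1 - fps_X) * SB + (2 * fps_X - 1)"
    unfolding SB b1 by (simp add: algebra_simps)
  have G': "Q * G = (1 - fps_X) * (\<Sum>w=1..n. a w * (- fps_X) ^ w)"
    unfolding G_def sum_distrib_left
  proof (rule sum.cong)
    fix w assume "w \<in> {1..n}"
    then have "W w n * Q = (1 - fps_X) * a w" by (intro WQ) auto
    then show "Q * ((- fps_X) ^ w * W w n) = (1 - fps_X) * (a w * (- fps_X) ^ w)"
      by (metis mult.assoc mult.commute)
  qed simp
  have "{..n} = insert 0 {1..n}" by auto
  then have G: "Q * G = (1 - fps_X) * SA - (1 - fps_X)"
    unfolding SA_def G' by (simp add: a_def algebra_simps sum_distrib_left)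
  have "fps_eq_upto n (Q * (F - (2 * fps_X - 1) + G)) (Q * (odd_qfact n * \<theta>))"
  proof -
    \<comment> \<open>The term \<open>1 - fps_X\<close> from \<open>Q * SB\<close> cancels the
      correction in \<open>Q * G\<close>, leaving \<open>\<theta>\<close>; Euler's identity then
      puts back the factor \<open>Q\<close>.\<close>
    have "Q * (F - (2 * fps_X - 1) + G) = (1 - fps_X) * (Q * SB) + ((1 - fps_X) * SA + (fps_X - 1))"
      unfolding F distrib_left G by (simp add: algebra_simps)
    also have "fps_eq_upto n \<dots> ((1 - fps_X) * 1 + (\<theta> + (fps_X - 1)))"
      by (intro fps_eq_upto_add fps_eq_upto_mult [OF fps_eq_upto_refl B] T fps_eq_upto_refl)
    also have "(1 - fps_X) * 1 + (\<theta> + (fps_X - 1)) = 1 * \<theta>" by simp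
    also have "fps_eq_upto n (1 * \<theta>) (Q * odd_qfact n * \<theta>)"
      unfolding Q_def by (intro fps_eq_upto_mult [OF _ fps_eq_upto_refl] fps_eq_upto_sym [OF Euler_odd_upto])
    finally show ?thesis by (simp only: mult.assoc)
  qed
  from fps_eq_upto_cancel [OF this Q0]
  have "(F - (2 * fps_X - 1) + G) $ n = (odd_qfact n * \<theta>) $ n"
    by (simp add: fps_eq_upto_def)
  \<comment> \<open>The correction for the indices 0 and 1 missing from \<open>F\<close> has degree
    1, so it is invisible from \<open>n = 2\<close> on.\<close>
  moreover have "(2 * fps_X - 1 :: real fps) $ n = 0"
    using assms by (simp add: numeral_fps_const)
  ultimately have FG: "F $ n + G $ n = (odd_qfact n * \<theta>) $ n" by simp
  have "sum crank_sign (partitions_of n) = (\<Sum>w\<in>{..n}. \<Sum>L | L \<in> partitions_of n \<and> ones L = w. crank_sign L)"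
  proof (rule sum.group [symmetric])
    have "ones L \<le> n" if "L \<in> partitions_of n" for L
    proof -
      have "L = filter_mset (\<lambda>x. x \<noteq> 1) L + replicate_mset (ones L) 1"
        by (auto simp: multiset_eq_iff ones_def)
      then have "sum_mset L = sum_mset (filter_mset (\<lambda>x. x \<noteq> 1) L + replicate_mset (ones L) 1)"
        by (rule arg_cong)
      also have "\<dots> = sum_mset (filter_mset (\<lambda>x. x \<noteq> 1) L) + ones L"
        by (simp only: sum_mset.union sum_mset_replicate_mset) simp
      finally have "sum_mset L = sum_mset (filter_mset (\<lambda>x. x \<noteq> 1) L) + ones L" .
      with that show ?thesis by (simp add: partitions_of_def)
    qed
    then show "ones ` partitions_of n \<subseteq> {..n}" by auto
  qed (simp_all add: finite_partitions_of)
  also have "{..n} = insert 0 {1..n}" by auto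
  also have "(\<Sum>w\<in>insert 0 {1..n}. \<Sum>L | L \<in> partitions_of n \<and> ones L = w. crank_sign L)
      = (\<Sum>L | L \<in> partitions_of n \<and> ones L = 0. crank_sign L) +
        (\<Sum>w=1..n. \<Sum>L | L \<in> partitions_of n \<and> ones L = w. crank_sign L)"
    by (subst sum.insert) auto
  also have "\<dots> = F $ n + G $ n"
    unfolding F_def G_def W_def fps_sum_nth [of _ "{1..n}"]
    using assms by (intro arg_cong2 [where f = "(+)"] sum.cong sum_crank_sign_no_ones sum_crank_sign_ones) auto
  finally show ?thesis unfolding FG \<theta>_def .
qed

section \<open>Sets of odd numbers\<close>

text \<open>Partitions into distinct odd parts, encoded as sets since no part repeats.\<close>

definition distinct_odd :: "nat \<Rightarrow> nat set set" where
  "distinct_odd m = {T. finite T \<and> (\<forall>j\<in>T. odd j) \<and> \<Sum>T = m}"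

lemma distinct_odd_subset: "T \<in> distinct_odd m \<Longrightarrow> T \<subseteq> {..m}"
  by (auto simp: distinct_odd_def intro: member_le_sum [where f = "\<lambda>x. x"])

lemma finite_distinct_odd: "finite (distinct_odd m)"
  by (rule finite_subset [of _ "Pow {..m}"]) (auto dest: distinct_odd_subset)

text \<open>Expanding the product, each set \<open>T\<close> of odd exponents contributes
  \<open>(-1) ^ card T\<close> to the coefficient at its sum; the triangle inequality drops the
  signs.\<close>

lemma abs_odd_qfact_nth_le: "\<bar>odd_qfact N $ m\<bar> \<le> real (card (distinct_odd m))"
proof -
  define A where "A = {j. j \<le> N \<and> odd j}"
  have fA: "finite A" unfolding A_def by auto
  have "odd_qfact N = (\<Sum>T\<in>Pow A. (-1) ^ card T * (\<Prod>j\<in>T. fps_X ^ j) * (\<Prod>j\<in>A-T. 1))"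
    unfolding odd_qfact_def A_def [symmetric] by (rule prod_diff_conv_sum [OF fA])
  also have "\<dots> = (\<Sum>T\<in>Pow A. fps_const ((-1) ^ card T) * fps_X ^ \<Sum>T)"
    by (intro sum.cong) (auto simp: power_sum fps_const_power [symmetric] simp flip: fps_const_neg)
  finally have "odd_qfact N $ m = (\<Sum>T\<in>Pow A. if m = \<Sum>T then (-1) ^ card T else 0)"
    by (simp add: fps_sum_nth if_distrib cong: if_cong)
  also have "\<dots> = (\<Sum>T | T \<subseteq> A \<and> m = \<Sum>T. (-1) ^ card T)"
    using fA by (simp add: sum.inter_filter [symmetric] Pow_def)
  finally have "\<bar>odd_qfact N $ m\<bar> \<le> (\<Sum>T | T \<subseteq> A \<and> m = \<Sum>T. \<bar>(-1) ^ card T\<bar>)"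
    by (simp only: sum_abs)
  also have "\<dots> = real (card {T. T \<subseteq> A \<and> m = \<Sum>T})"
    by simp
  also have "\<dots> \<le> real (card (distinct_odd m))"
    using fA by (intro of_nat_mono card_mono finite_distinct_odd)
      (auto simp: distinct_odd_def A_def intro: finite_subset)
  finally show ?thesis .
qed

text \<open>The sum is only bounded, because removing the largest part leaves varying sums.\<close>

definition bounded_odd :: "nat \<Rightarrow> nat set set" where
  "bounded_odd m = {T. finite T \<and> (\<forall>j\<in>T. odd j) \<and> \<Sum>T \<le> m}"

lemma finite_bounded_odd: "finite (bounded_odd m)"
proof (rule finite_subset)
  show "bounded_odd m \<subseteq> (\<Union>k\<le>m. distinct_odd k)"
    by (auto simp: bounded_odd_def distinct_odd_def)
qed (simp add: finite_distinct_odd)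

text \<open>Remove the largest part. If it is smaller than \<open>floor_sqrt n\<close>, then the whole set
  has sum at most \<open>n - floor_sqrt n\<close> already.\<close>

lemma card_distinct_odd_le:
  assumes "m \<le> n"
  shows "card (distinct_odd m) \<le> card (bounded_odd (n - floor_sqrt n))"
proof (rule card_inj_on_le [OF _ _ finite_bounded_odd])
  define s where "s = floor_sqrt n"
  have gauss: "\<Sum>{..<k} + k \<le> k\<^sup>2" for k :: nat
    by (induction k) (auto simp: power2_eq_square)
  have s2: "s\<^sup>2 \<le> n" by (simp add: s_def)
  have rem: "\<Sum>T = Max T + \<Sum>(T - {Max T})" if "finite T" "T \<noteq> {}" for T :: "nat set"
    using that by (intro sum.remove) auto
  \<comment> \<open>The removed element is \<open>m\<close> minus the sum of the rest. For
    \<open>m = 0\<close> there is only the empty set, which has no maximum.\<close>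
  show "inj_on (\<lambda>T. T - {Max T}) (distinct_odd m)"
  proof (rule inj_onI)
    fix T U assume T: "T \<in> distinct_odd m" and U: "U \<in> distinct_odd m" and e: "T - {Max T} = U - {Max U}"
    show "T = U"
    proof (cases "m = 0")
      case True
      then have "V = {}" if "V \<in> distinct_odd m" for V
        using distinct_odd_subset [OF that] that by (fastforce simp: distinct_odd_def)
      then show ?thesis using T U by blast
    next
      case False
      then have "V \<noteq> {}" "finite V" if "V \<in> distinct_odd m" for V
        using that by (cases "V = {}"; simp add: distinct_odd_def)+
      with T U have ne: "T \<noteq> {}" "U \<noteq> {}" "finite T" "finite U" by blast+
      have "Max T + \<Sum>(T - {Max T}) = Max U + \<Sum>(U - {Max U})"
        unfolding rem [OF ne(3,1), symmetric] rem [OF ne(4,2), symmetric]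
        using T U by (simp add: distinct_odd_def)
      then have "Max T = Max U" unfolding e by simp
      then show ?thesis using e ne Max_in by (metis insert_Diff)
    qed
  qed
  have "\<Sum>(T - {Max T}) \<le> n - s" if T: "T \<in> distinct_odd m" for T
  proof (cases "T \<noteq> {} \<and> Max T \<ge> s")
    case True
    moreover have "finite T" "\<Sum>T = m" using T by (simp_all add: distinct_odd_def)
    ultimately show ?thesis
      using rem [of T] assms by linarith
  next
    case False
    have fin: "finite T" using T by (simp add: distinct_odd_def)
    have "j < s" if "j \<in> T" for j
      using False that Max_ge [OF fin that] by (cases "T = {}") simp_all
    then have "T \<subseteq> {..<s}" by auto
    then have "\<Sum>(T - {Max T}) \<le> \<Sum>{..<s}" by (intro sum_mono2) blast+
    then show ?thesis using gauss [of s] s2 by linarith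
  qed
  then show "(\<lambda>T. T - {Max T}) ` distinct_odd m \<subseteq> bounded_odd (n - floor_sqrt n)"
    by (auto simp: bounded_odd_def distinct_odd_def s_def)
qed

text \<open>Every set either avoids 1 or arises by inserting 1 into one that does. Avoiding 1 keeps
  the part 1 free as filler.\<close>

lemma card_bounded_odd_le:
  "card (bounded_odd m) \<le> 2 * card {T \<in> bounded_odd m. 1 \<notin> T}"
proof -
  let ?D = "{T \<in> bounded_odd m. 1 \<notin> T}"
  have fin: "finite ?D" by (rule finite_subset [OF _ finite_bounded_odd [of m]]) auto
  have "T \<in> ?D \<union> insert 1 ` ?D" if T: "T \<in> bounded_odd m" for T
  proof (cases "1 \<in> T")
    case True
    have "\<Sum>(T - {1}) \<le> \<Sum>T" using T by (intro sum_mono2) (auto simp: bounded_odd_def)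
    then have "T - {1} \<in> ?D" using T by (auto simp: bounded_odd_def)
    moreover have "T = insert 1 (T - {1})" using True by auto
    ultimately show ?thesis by blast
  qed (use T in auto)
  then have "card (bounded_odd m) \<le> card (?D \<union> insert 1 ` ?D)"
    using fin by (intro card_mono) auto
  also have "\<dots> \<le> card ?D + card (insert 1 ` ?D)" by (rule card_Un_le)
  also have "card (insert 1 ` ?D) \<le> card ?D" using fin by (rule card_image_le)
  finally show ?thesis by simp
qed

text \<open>A set of odd parts other than 1 can be completed by at most \<open>s div 6\<close> parts 2, at most
  \<open>s div 6\<close> parts 4, and parts 1 to a partition of \<open>n\<close>. It is the quadratic number of choices
  that beats the factor of order \<open>sqrt n\<close> from the theta series.\<close>

lemma partition_number_ge:
  assumes "s \<le> n"
  shows "card {T \<in> bounded_odd (n - s). 1 \<notin> T} * (Suc (s div 6))\<^sup>2 \<le> partition_number n"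
proof -
  let ?D = "{T \<in> bounded_odd (n - s). 1 \<notin> T}"
  \<comment> \<open>Chosen so that \<open>2 * a + 4 * b \<le> s\<close> for all \<open>a\<close> and
    \<open>b\<close> up to this bound.\<close>
  let ?r = "s div 6"
  define f where "f = (\<lambda>(T, a, b). mset_set T + replicate_mset a 2 + replicate_mset b 4
      + replicate_mset (n - (\<Sum>T + 2 * a + 4 * b)) (1 :: nat))"
  have count_f: "count (f (T, a, b)) x = of_bool (x \<in> T) + a * of_bool (x = 2) + b * of_bool (x = 4)
      + (n - (\<Sum>T + 2 * a + 4 * b)) * of_bool (x = 1)" if "finite T" for T a b x
    using that by (simp add: f_def count_mset_set')
  have notin: "2 \<notin> T" "4 \<notin> T" "1 \<notin> T" "0 \<notin> T" if "T \<in> ?D" for T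
  proof -
    have od: "\<forall>j\<in>T. odd j" using that by (simp add: bounded_odd_def)
    show "2 \<notin> T" "4 \<notin> T" "0 \<notin> T"
      using bspec [OF od, of 2] bspec [OF od, of 4] bspec [OF od, of 0] by auto
    show "1 \<notin> T" using that by simp
  qed
  \<comment> \<open>As \<open>T\<close> has odd elements only, the multiplicities of 2 and 4 return
    \<open>a\<close> and \<open>b\<close>; those of the numbers other than 1, 2, 4 return
    \<open>T\<close>.\<close>
  have "inj_on f (?D \<times> {..?r} \<times> {..?r})"
  proof (rule inj_onI)
    fix p p'
    assume "p \<in> ?D \<times> {..?r} \<times> {..?r}" "p' \<in> ?D \<times> {..?r} \<times> {..?r}" and fp: "f p = f p'"
    then obtain T a b U c d where p: "p = (T, a, b)" "p' = (U, c, d)" and T: "T \<in> ?D" and U: "U \<in> ?D"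
      by blast
    have e: "f (T, a, b) = f (U, c, d)" using fp unfolding p .
    have fin: "finite T" "finite U" using T U by (auto simp: bounded_odd_def)
    have cnt: "count (f (T, a, b)) x = count (f (U, c, d)) x" for x by (simp only: e)
    note cnt = cnt [unfolded count_f [OF fin(1)] count_f [OF fin(2)]]
    have "a = c" using cnt [of 2] notin(1) [OF T] notin(1) [OF U] by simp
    moreover have "b = d" using cnt [of 4] notin(2) [OF T] notin(2) [OF U] by simp
    moreover have "x \<in> T \<longleftrightarrow> x \<in> U" for x
    proof (cases "x = 1 \<or> x = 2 \<or> x = 4")
      case True then show ?thesis using notin [OF T] notin [OF U] by blast
    next
      case False
      then have "x \<noteq> 1" "x \<noteq> 2" "x \<noteq> 4" by auto
      with cnt [of x] have "of_bool (x \<in> T) = (of_bool (x \<in> U) :: nat)" by simp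
      then show ?thesis by (simp only: of_bool_eq_iff)
    qed
    ultimately show "p = p'" unfolding p by blast
  qed
  moreover have "f (T, a, b) \<in> partitions_of n" if T: "T \<in> ?D" and ab: "a \<le> ?r" "b \<le> ?r" for T a b
  proof -
    have "sum_mset (mset_set T) = \<Sum>T" using sum_unfold_sum_mset [of "\<lambda>x. x" T] by simp
    moreover have "\<Sum>T + 2 * a + 4 * b \<le> n"
    proof -
      have "\<Sum>T \<le> n - s" using T by (simp add: bounded_odd_def)
      then show ?thesis using ab assms by linarith
    qed
    moreover have "0 \<notin># mset_set T" using notin [OF T] by (cases "finite T") auto
    ultimately show ?thesis by (simp add: f_def partitions_of_def)
  qed
  ultimately have "card (?D \<times> {..?r} \<times> {..?r}) \<le> card (partitions_of n)"
    by (intro card_inj_on_le [OF _ _ finite_partitions_of]) auto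
  then show ?thesis
    by (simp add: card_cartesian_product partition_number_def power2_eq_square)
qed

section \<open>Comparison with the partition number\<close>

text \<open>Only the theta terms with \<open>k\<^sup>2 \<le> n\<close> reach coefficient
  \<open>n\<close>. Each contributes at most \<open>2 * B\<close> and the constant term at most
  \<open>B\<close>, in total \<open>(2 * s + 1) * B\<close>.\<close>

lemma abs_sum_crank_sign_le:
  assumes "n \<ge> 2"
  shows "\<bar>\<Sum>L\<in>partitions_of n. crank_sign L\<bar>
    \<le> 2 * real (Suc (floor_sqrt n)) * real (card (bounded_odd (n - floor_sqrt n)))"
proof -
  define s where "s = floor_sqrt n"
  define B where "B = real (card (bounded_odd (n - s)))"
  have odd_le: "\<bar>odd_qfact n $ m\<bar> \<le> B" if "m \<le> n" for m
    using abs_odd_qfact_nth_le [of n m] card_distinct_odd_le [OF that] by (simp add: B_def s_def)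
  have B0: "B \<ge> 0" by (simp add: B_def)
  have term_eq: "(odd_qfact n * (2 * ((-1) ^ k * fps_X ^ k\<^sup>2))) $ n
      = 2 * (-1) ^ k * (if n < k\<^sup>2 then 0 else odd_qfact n $ (n - k\<^sup>2))" for k
  proof -
    have "odd_qfact n * (2 * ((-1) ^ k * fps_X ^ k\<^sup>2))
        = fps_const (2 * (-1) ^ k) * (fps_X ^ k\<^sup>2 * odd_qfact n)"
      by (simp add: minus_one_power_iff numeral_fps_const ac_simps flip: fps_const_neg)
    then show ?thesis
      by (simp only: fps_mult_left_const_nth fps_X_power_mult_nth)
  qed
  have "(\<Sum>L\<in>partitions_of n. crank_sign L)
      = odd_qfact n $ n + (\<Sum>k=1..n. (odd_qfact n * (2 * ((-1) ^ k * fps_X ^ k\<^sup>2))) $ n)"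
    unfolding sum_crank_sign_eq [OF assms]
    by (simp only: distrib_left mult_1_right fps_add_nth sum_distrib_left fps_sum_nth)
  also have "\<bar>\<dots>\<bar> \<le> B + (\<Sum>k=1..n. if k \<le> s then 2 * B else 0)"
  proof (rule order_trans [OF abs_triangle_ineq add_mono])
    show "\<bar>odd_qfact n $ n\<bar> \<le> B" by (rule odd_le) simp
    have "\<bar>(odd_qfact n * (2 * ((-1) ^ k * fps_X ^ k\<^sup>2))) $ n\<bar> \<le> (if k \<le> s then 2 * B else 0)" for k
      unfolding term_eq s_def le_floor_sqrt_iff using odd_le [of "n - k\<^sup>2"]
      by (simp add: abs_mult power_abs)
    then show "\<bar>\<Sum>k=1..n. (odd_qfact n * (2 * ((-1) ^ k * fps_X ^ k\<^sup>2))) $ n\<bar>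
        \<le> (\<Sum>k=1..n. if k \<le> s then 2 * B else 0)"
      by (intro order_trans [OF sum_abs] sum_mono)
  qed
  also have "(\<Sum>k=1..n. if k \<le> s then 2 * B else 0) = (\<Sum>k=1..s. 2 * B)"
    using floor_sqrt_le [of n] by (intro sum.mono_neutral_cong_right) (auto simp: s_def)
  finally show ?thesis
    using B0 by (simp add: B_def s_def algebra_simps)
qed

text \<open>The numerator is at most of order \<open>r * d\<close> and the denominator at least
  \<open>d * r\<^sup>2\<close>, where \<open>r\<close> is of order \<open>sqrt n\<close>.\<close>

lemma abs_sum_crank_sign_div_le:
  assumes "n \<ge> 2"
  shows "\<bar>(\<Sum>L\<in>partitions_of n. crank_sign L) / real (partition_number n)\<bar> \<le> 144 / sqrt (real n)"
proof -
  define s where "s = floor_sqrt n"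
  define r where "r = Suc (s div 6)"
  define d where "d = card {T \<in> bounded_odd (n - s). 1 \<notin> T}"
  have "finite {T \<in> bounded_odd (n - s). 1 \<notin> T}"
    by (rule finite_subset [OF _ finite_bounded_odd [of "n - s"]]) auto
  moreover have "{} \<in> {T \<in> bounded_odd (n - s). 1 \<notin> T}" by (simp add: bounded_odd_def)
  ultimately have d: "d > 0" unfolding d_def by (metis card_gt_0_iff empty_iff)
  have r: "Suc s \<le> 6 * r \<and> r > 0" unfolding r_def by presburger
  have "d * r\<^sup>2 \<le> partition_number n"
    unfolding d_def r_def by (rule partition_number_ge) (simp add: s_def floor_sqrt_le)
  then have p: "real d * real r ^ 2 \<le> real (partition_number n)"
    by (metis of_nat_le_iff of_nat_mult of_nat_power)
  have dr: "0 < real d * real r ^ 2" using d r by simp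
  have "\<bar>\<Sum>L\<in>partitions_of n. crank_sign L\<bar> \<le> 2 * real (Suc s) * real (card (bounded_odd (n - s)))"
    using abs_sum_crank_sign_le [OF assms] by (simp add: s_def)
  \<comment> \<open>The 6 comes from \<open>Suc s \<le> 6 * r\<close>, the second 2 from discarding
    sets that contain 1. In all this gives 24, and \<open>sqrt n \<le> 6 * r\<close> later turns it
    into 144.\<close>
  also have "\<dots> \<le> 2 * real (6 * r) * real (2 * d)"
    unfolding d_def using r card_bounded_odd_le [of "n - s"] by (intro mult_mono of_nat_mono) auto
  finally have "\<bar>\<Sum>L\<in>partitions_of n. crank_sign L\<bar> \<le> 24 * real r * real d" by simp
  then have "\<bar>\<Sum>L\<in>partitions_of n. crank_sign L\<bar> / real (partition_number n)
      \<le> 24 * real r * real d / (real d * real r ^ 2)"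
    using p dr by (intro frac_le) auto
  also have "\<dots> = 24 / real r"
    using d r by (simp add: power2_eq_square)
  also have "\<dots> \<le> 144 / sqrt (real n)"
  proof -
    have "n \<le> (Suc s)\<^sup>2" unfolding s_def by (rule less_imp_le [OF Suc_floor_sqrt_power2_gt])
    then have "real n \<le> real (Suc s) ^ 2" by (metis of_nat_le_iff of_nat_power)
    then have "sqrt (real n) \<le> real (Suc s)" by (intro real_le_lsqrt) auto
    also have "\<dots> \<le> 6 * real r" using r by linarith
    finally show ?thesis using assms r by (simp add: field_simps)
  qed
  finally show ?thesis by simp
qed

theorem theorem2p3:
  fixes k :: nat
  assumes "k = 0 \<or> k = 1"
  shows "(\<lambda>n. real (crank_parity_count k n) / real (partition_number n)) \<longlonglongrightarrow> 1 / 2"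
proof -
  define c where "c n = (\<Sum>L\<in>partitions_of n. crank_sign L)" for n
  have p_pos: "partition_number n > 0" for n
  proof -
    have "replicate_mset n 1 \<in> partitions_of n" by (simp add: partitions_of_def)
    then show ?thesis
      unfolding partition_number_def using finite_partitions_of card_gt_0_iff by blast
  qed
  have "(\<lambda>n. 144 / sqrt (real n)) \<longlonglongrightarrow> 0"
    by (intro tendsto_divide_0 [OF tendsto_const] filterlim_at_top_imp_at_infinity
        filterlim_compose [OF sqrt_at_top filterlim_real_sequentially])
  then have lim0: "(\<lambda>n. c n / real (partition_number n)) \<longlonglongrightarrow> 0"
  proof (rule tendsto_0_le [where K = 1])
    show "\<forall>\<^sub>F n in sequentially. norm (c n / real (partition_number n)) \<le> norm (144 / sqrt (real n)) * 1"
      using eventually_ge_at_top [of 2]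
    proof eventually_elim
      case (elim n)
      then show ?case using abs_sum_crank_sign_div_le [of n] by (simp add: c_def)
    qed
  qed
  have ratio: "real (crank_parity_count k n) / real (partition_number n)
      = 1 / 2 + (-1) ^ k * (c n / real (partition_number n)) / 2" for n
  proof -
    \<comment> \<open>The indicator of a parity class as an average of characters; summing it gives
      2 M_k(n) = p(n) + (-1)^k (M_0(n) - M_1(n)).\<close>
    have pointwise: "2 * of_bool (crank L mod 2 = int k) = 1 + (-1) ^ k * crank_sign L" for L
    proof -
      have "crank_sign L = (if crank L mod 2 = 0 then 1 else -1)"
        by (simp only: crank_sign_def even_iff_mod_2_eq_zero)
      moreover have "crank L mod 2 = 0 \<or> crank L mod 2 = 1"
        by presburger
      ultimately show ?thesis
        using assms by (elim disjE) simp_all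
    qed
    have "real (crank_parity_count k n) = (\<Sum>L\<in>partitions_of n. of_bool (crank L mod 2 = int k))"
    proof -
      have "partitions_of n \<inter> {L. crank L mod 2 = int k} = {L \<in> partitions_of n. crank L mod 2 = int k}"
        by blast
      then show ?thesis
        unfolding crank_parity_count_def by (subst sum_of_bool_eq) (simp_all add: finite_partitions_of)
    qed
    then have "2 * real (crank_parity_count k n) = (\<Sum>L\<in>partitions_of n. 1 + (-1) ^ k * crank_sign L)"
      by (simp only: sum_distrib_left pointwise)
    also have "\<dots> = real (partition_number n) + (-1) ^ k * c n"
      by (simp only: sum.distrib sum_distrib_left c_def partition_number_def real_of_card)
    finally have "2 * real (crank_parity_count k n) = real (partition_number n) + (-1) ^ k * c n" .
    then show ?thesis
      using p_pos [of n] by (simp add: field_simps)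
  qed
  have "(\<lambda>n. 1 / 2 + (-1) ^ k * (c n / real (partition_number n)) / 2) \<longlonglongrightarrow> 1 / 2 + (-1) ^ k * 0 / 2"
    by (intro tendsto_intros lim0) simp
  then show ?thesis by (simp add: ratio)
qed

end
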